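(* For every integer $b>4$, $$R_{(b,4)}<\left(\frac{1}{\log b}+\frac{b^2}{(b^2-3b+2)\log(b-2)}\right)^{-1}.$$
   Context: All logarithms are to base 2. For integers $b\ge k$ and $n\ge1$, a $(b,k)$-hash code of length $n$ is a subset $C\subseteq\{1,\dots,b\}^n$ such that for any $k$ distinct elements of $C$ there is a coordinate in which they are pairwise distinct; $A(b,k,n)$ is the largest size of such a code and $R_{(b,k)}=\limsup_{n\to\infty}\frac1n\log A(b,k,n)$. *)

theory Defs
  imports "HOL-Analysis.Analysis" "HOL-Library.Liminf_Limsup"
begin

definition words :: "nat \<Rightarrow> nat \<Rightarrow> (nat \<Rightarrow> nat) set" where
  "words b n = PiE {0..<n} (\<lambda>_. {1..b})"

definition is_hash_code :: "nat \<Rightarrow> nat \<Rightarrow> nat \<Rightarrow> (nat \<Rightarrow> nat) set \<Rightarrow> bool" where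
  "is_hash_code b k n C \<longleftrightarrow> C \<subseteq> words b n \<and>
     (\<forall>S \<subseteq> C. card S = k \<longrightarrow> (\<exists>i \<in> {0..<n}. inj_on (\<lambda>x. x i) S))"

definition A_hash :: "nat \<Rightarrow> nat \<Rightarrow> nat \<Rightarrow> nat" where
  "A_hash b k n = Max {card C | C. is_hash_code b k n C}"

definition R_hash :: "nat \<Rightarrow> nat \<Rightarrow> ereal" where
  "R_hash b k = limsup (\<lambda>n. ereal (log 2 (real (A_hash b k n)) / real n))"

end

theory Submission
  imports Defs "HOL-Real_Asymp.Real_Asymp"
begin

text \<open>
  Fix two codewords \<open>x, x'\<close> of a \<open>(b,4)\<close>-hash code of size \<open>M\<close>. Hansel's argument bounds \<open>ln M\<close> by
  \<open>ln (b - 2)\<close> times the average over codewords \<open>y\<close> of the number of coordinates in which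
  \<open>x, x', y\<close> are pairwise distinct. If \<open>x, x'\<close> are drawn independently from a random class of a family of
  subcodes covering every codeword equally often, then each coordinate contributes at most
  \<open>\<kappa> = (1 - 1/b)(1 - 2/b)\<close> on average, whatever the family is.

  Classes of codewords agreeing on a prefix of length about \<open>ln M / ln b\<close> would give the bound with
  \<open>\<le>\<close>. For strictness, the prefix is cut into blocks of constant length \<open>T = b\<^sup>5\<close>, and the classes are
  indexed by a centre in each block: a codeword belongs to the class if every block is within Hamming
  distance one of its centre. Two members of a class then differ in at most two coordinates
  per block, while a block only costs a factor \<open>b\<^sup>T / (1 + T (b - 1)) \<le> b\<^bsup>T - 5\<^esup>\<close> in class size instead of \<open>b\<^sup>T\<close>.
  This trade is profitable because \<open>5 \<kappa> > 2\<close>.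
\<close>

section \<open>Hansel's inequality for a pair of codewords\<close>

definition rainbow :: "nat set \<Rightarrow> (nat \<Rightarrow> nat) \<Rightarrow> (nat \<Rightarrow> nat) \<Rightarrow> (nat \<Rightarrow> nat) \<Rightarrow> nat set" where
  "rainbow I x y z = {i \<in> I. x i \<noteq> y i \<and> x i \<noteq> z i \<and> y i \<noteq> z i}"

lemma finite_words [simp]: "finite (words b n)"
  unfolding words_def by (intro finite_PiE) auto

lemma hash_code_finite: "is_hash_code b k n C \<Longrightarrow> finite C"
  unfolding is_hash_code_def using finite_subset[OF _ finite_words] by blast

lemma hash_code_symbol:
  assumes "is_hash_code b k n C" "x \<in> C" "i < n"
  shows "x i \<in> {1..b}"
  using assms unfolding is_hash_code_def words_def by (auto simp: PiE_iff)

text \<open>Choose a symbol outside \<open>{x i, x' i}\<close> at every coordinate where \<open>x\<close> and \<open>x'\<close> differ.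
  By the hash property the sets of choices compatible with the various \<open>y\<close> are disjoint.\<close>

lemma hash_code_kraft:
  assumes code: "is_hash_code b 4 n C" and xC: "x \<in> C" "x' \<in> C" "x \<noteq> x'" and b: "b \<ge> 3"
  shows "(\<Sum>y\<in>C - {x,x'}. (1 / (real b - 2)) ^ card (rainbow {0..<n} x x' y)) \<le> 1"
proof -
  define I where "I = {i\<in>{0..<n}. x i \<noteq> x' i}"
  define F where "F = (\<lambda>i. {1..b} - {x i, x' i})"
  define S where "S = (\<lambda>y. PiE I (\<lambda>i. if i \<in> rainbow {0..<n} x x' y then {y i} else F i))"
  have finI: "finite I" by (simp add: I_def)
  have cardF: "card (F i) = b - 2" if "i \<in> I" for i
  proof -
    have "{x i, x' i} \<subseteq> {1..b}" "x i \<noteq> x' i"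
      using that hash_code_symbol[OF code] xC by (auto simp: I_def)
    then show ?thesis
      unfolding F_def by (subst card_Diff_subset) auto
  qed
  have sub: "rainbow {0..<n} x x' y \<subseteq> I" for y
    by (auto simp: rainbow_def I_def)
  have cardS: "card (S y) = (b - 2) ^ (card I - card (rainbow {0..<n} x x' y))" for y
  proof -
    let ?r = "rainbow {0..<n} x x' y"
    have "card (S y) = (\<Prod>i\<in>I. if i \<in> ?r then 1 else b - 2)"
      unfolding S_def by (subst card_PiE[OF finI]) (auto intro!: prod.cong simp: cardF)
    also have "\<dots> = (\<Prod>i\<in>I - ?r. b - 2)"
      by (intro prod.mono_neutral_cong_right) (use finI in auto)
    also have "\<dots> = (b - 2) ^ (card I - card ?r)"
      using sub[of y] finI by (simp add: card_Diff_subset finite_subset)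
    finally show ?thesis .
  qed
  have SF: "S y \<subseteq> PiE I F" if "y \<in> C - {x,x'}" for y
    unfolding S_def using hash_code_symbol[OF code, of y] that
    by (intro PiE_mono) (auto simp: F_def rainbow_def)
  have disj: "S y \<inter> S y' = {}" if "y \<in> C - {x,x'}" "y' \<in> C - {x,x'}" "y \<noteq> y'" for y y'
  proof -
    \<comment> \<open>A coordinate separating these four words is rainbow for both \<open>y\<close>
      and \<open>y'\<close>, so there \<open>S y\<close> forces the symbol \<open>y i\<close> and
      \<open>S y'\<close> the different symbol \<open>y' i\<close>.\<close>
    have "card {x,x',y,y'} = 4" "{x,x',y,y'} \<subseteq> C"
      using that xC by auto
    then obtain i where i: "i < n" "inj_on (\<lambda>w. w i) {x,x',y,y'}"
      using code unfolding is_hash_code_def by (metis atLeastLessThan_iff)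
    have ne: "x i \<noteq> x' i" "x i \<noteq> y i" "x' i \<noteq> y i" "x i \<noteq> y' i" "x' i \<noteq> y' i" "y i \<noteq> y' i"
      using i(2) that xC(3) unfolding inj_on_def by blast+
    then have "i \<in> I" "i \<in> rainbow {0..<n} x x' y" "i \<in> rainbow {0..<n} x x' y'"
      using i(1) by (auto simp: I_def rainbow_def)
    then have "g i = y i" "h i = y' i" if "g \<in> S y" "h \<in> S y'" for g h
      using that by (auto simp: S_def PiE_iff split: if_splits)
    with ne(6) show ?thesis by fastforce
  qed
  have fin: "finite (C - {x,x'})" using hash_code_finite[OF code] by simp
  have finF: "finite (PiE I F)" using finI by (intro finite_PiE) (auto simp: F_def)
  have "(\<Sum>y\<in>C-{x,x'}. card (S y)) = card (\<Union>y\<in>C-{x,x'}. S y)"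
    by (subst card_UN_disjoint) (use fin disj SF finite_subset[OF _ finF] in auto)
  also have "\<dots> \<le> card (PiE I F)"
    using SF finF by (intro card_mono) auto
  also have "\<dots> = (b - 2) ^ card I"
    using finI by (simp add: card_PiE cardF)
  finally have "(\<Sum>y\<in>C-{x,x'}. card (S y)) \<le> (b - 2) ^ card I" .
  then have "real (\<Sum>y\<in>C-{x,x'}. card (S y)) \<le> real ((b - 2) ^ card I)"
    by (rule of_nat_mono)
  then have le: "(\<Sum>y\<in>C-{x,x'}. (real b - 2) ^ (card I - card (rainbow {0..<n} x x' y)))
      \<le> (real b - 2) ^ card I"
    using b by (simp add: cardS of_nat_diff)
  have "(\<Sum>y\<in>C - {x,x'}. (1 / (real b - 2)) ^ card (rainbow {0..<n} x x' y))
     = (\<Sum>y\<in>C-{x,x'}. (real b - 2) ^ (card I - card (rainbow {0..<n} x x' y))) / (real b - 2) ^ card I"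
    unfolding sum_divide_distrib
    using b card_mono[OF finI sub]
    by (intro sum.cong) (auto simp: power_diff power_one_over field_simps)
  also have "\<dots> \<le> 1" using le b by (simp add: divide_le_eq_1)
  finally show ?thesis .
qed

text \<open>Jensen's inequality for the exponential, obtained from its tangent at the mean exponent
  \<open>a\<close>. For \<open>c > 1\<close> this is the familiar fact that a Kraft sum of at most 1
  forces a mean length of at least the base-\<open>c\<close> logarithm of
  \<open>card Y\<close>.\<close>

lemma ln_card_le_of_kraft:
  fixes c :: real and N :: "'a \<Rightarrow> nat"
  assumes fin: "finite Y" and c: "c > 0" and kraft: "(\<Sum>y\<in>Y. (1 / c) ^ N y) \<le> 1"
  shows "card Y * ln (card Y) \<le> ln c * (\<Sum>y\<in>Y. real (N y))"
proof (cases "Y = {}")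
  case False
  define d where "d = real (card Y)"
  define a where "a = (\<Sum>y\<in>Y. real (N y)) / d"
  have d: "d > 0" using False fin by (simp add: d_def card_gt_0_iff)
  have sumN: "(\<Sum>y\<in>Y. real (N y)) = d * a" using d by (simp add: a_def)
  have *: "1 - (N y - a) * ln c \<le> (1 / c) ^ N y * exp (a * ln c)" for y
  proof -
    have "(1 / c) ^ N y = exp (- (N y * ln c))"
      using c by (simp add: power_one_over exp_minus exp_of_nat_mult inverse_eq_divide)
    then have "(1 / c) ^ N y * exp (a * ln c) = exp (- ((N y - a) * ln c))"
      by (simp add: exp_add [symmetric] algebra_simps)
    then show ?thesis using exp_ge_add_one_self[of "- ((N y - a) * ln c)"] by simp
  qed
  have "(\<Sum>y\<in>Y. 1 - (N y - a) * ln c) = d - ((\<Sum>y\<in>Y. real (N y)) - d * a) * ln c"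
    by (simp add: sum_subtractf sum_distrib_right[symmetric] d_def)
  then have "d = (\<Sum>y\<in>Y. 1 - (N y - a) * ln c)" using sumN by simp
  also have "\<dots> \<le> (\<Sum>y\<in>Y. (1 / c) ^ N y) * exp (a * ln c)"
    unfolding sum_distrib_right by (intro sum_mono *)
  also have "\<dots> \<le> exp (a * ln c)"
    using kraft by (simp add: mult_le_cancel_right1)
  finally have "ln d \<le> a * ln c" using d by (metis ln_exp ln_le_cancel_iff exp_gt_zero)
  then have "d * ln d \<le> d * (a * ln c)" using d by simp
  then show ?thesis using sumN by (simp add: d_def mult_ac)
qed simp

lemma hash_code_hansel:
  assumes code: "is_hash_code b 4 n C" and xC: "x \<in> C" "x' \<in> C" "x \<noteq> x'" and b: "b \<ge> 3"
  shows "(real (card C) - 2) * ln (real (card C) - 2)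
    \<le> ln (real b - 2) * (\<Sum>y\<in>C. real (card (rainbow {0..<n} x x' y)))"
proof -
  have fin: "finite C" using code by (rule hash_code_finite)
  have 2: "{x, x'} \<subseteq> C" "card {x,x'} = 2" using xC by auto
  then have "card C \<ge> 2" using card_mono[OF fin] by metis
  then have card: "real (card (C - {x,x'})) = real (card C) - 2"
    using 2 by (simp add: card_Diff_subset)
  \<comment> \<open>The terms \<open>y = x\<close> and \<open>y = x'\<close> vanish, so the sum may
    run over all of \<open>C\<close>; the later averages can then draw \<open>y\<close>
    independently of the pair.\<close>
  have "(\<Sum>y\<in>C - {x,x'}. real (card (rainbow {0..<n} x x' y)))
      = (\<Sum>y\<in>C. real (card (rainbow {0..<n} x x' y)))"
    by (intro sum.mono_neutral_left fin) (auto simp: rainbow_def)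
  then show ?thesis
    using ln_card_le_of_kraft[OF _ _ hash_code_kraft[OF assms]] fin b card by simp
qed

section \<open>Pairwise distinct triples at a single coordinate\<close>

lemma sum_triple_product:
  fixes F G H :: "'a \<Rightarrow> 'b \<Rightarrow> real"
  shows "(\<Sum>x\<in>X. \<Sum>y\<in>Y. \<Sum>z\<in>Z. \<Sum>a\<in>A. F a x * G a y * H a z)
     = (\<Sum>a\<in>A. sum (F a) X * sum (G a) Y * sum (H a) Z)"
proof -
  have "(\<Sum>x\<in>X. \<Sum>y\<in>Y. \<Sum>z\<in>Z. \<Sum>a\<in>A. F a x * G a y * H a z)
     = (\<Sum>x\<in>X. \<Sum>y\<in>Y. \<Sum>a\<in>A. \<Sum>z\<in>Z. F a x * G a y * H a z)"
    by (intro sum.cong refl sum.swap)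
  also have "\<dots> = (\<Sum>x\<in>X. \<Sum>a\<in>A. \<Sum>y\<in>Y. \<Sum>z\<in>Z. F a x * G a y * H a z)"
    by (intro sum.cong refl sum.swap)
  also have "\<dots> = (\<Sum>a\<in>A. \<Sum>x\<in>X. \<Sum>y\<in>Y. \<Sum>z\<in>Z. F a x * G a y * H a z)"
    by (rule sum.swap)
  also have "\<dots> = (\<Sum>a\<in>A. sum (F a) X * sum (G a) Y * sum (H a) Z)"
    by (simp add: sum_distrib_left[symmetric] sum_distrib_right[symmetric])
  finally show ?thesis .
qed

text \<open>Inclusion-exclusion on coincidences: a triple of equal symbols is subtracted three
  times, hence the correction by 2. Splitting each coincidence by its common symbol turns the triple
  sums into products of symbol counts.\<close>

lemma rainbow_triple_sum:
  fixes col :: "'b \<Rightarrow> nat" and k :: "'b set \<Rightarrow> nat \<Rightarrow> real"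
  assumes fin: "finite X" "finite Y" "finite A"
    and col: "\<And>x. x \<in> X \<Longrightarrow> col x \<in> A" "\<And>y. y \<in> Y \<Longrightarrow> col y \<in> A"
  defines "k \<equiv> \<lambda>S a. real (card {x \<in> S. col x = a})"
  shows "(\<Sum>x\<in>X. \<Sum>x'\<in>X. \<Sum>y\<in>Y. of_bool (col x \<noteq> col x' \<and> col x \<noteq> col y \<and> col x' \<noteq> col y))
    = real (card X)^2 * card Y - card Y * (\<Sum>a\<in>A. k X a ^ 2)
      - 2 * card X * (\<Sum>a\<in>A. k X a * k Y a) + 2 * (\<Sum>a\<in>A. k X a ^ 2 * k Y a)"
proof -
  define e :: "nat \<Rightarrow> 'b \<Rightarrow> real" where "e = (\<lambda>a x. of_bool (col x = a))"
  have k: "sum (e a) S = k S a" if "finite S" for S a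
    using that by (simp add: e_def k_def of_bool_def sum.If_cases Int_def)
  have eq: "of_bool (u = v) = (\<Sum>a\<in>A. of_bool (u = a) * of_bool (v = a) :: real)"
    if "u \<in> A" for u v :: nat
  proof -
    have "(\<Sum>a\<in>A. of_bool (u = a) * of_bool (v = a) :: real) = (\<Sum>a\<in>A. if a = u then of_bool (u = v) else 0)"
      by (intro sum.cong) auto
    then show ?thesis using fin(3) that by simp
  qed
  have eq3: "of_bool (u = v \<and> u = w) = (\<Sum>a\<in>A. of_bool (u = a) * of_bool (v = a) * of_bool (w = a) :: real)"
    if "u \<in> A" for u v w :: nat
  proof -
    have "(\<Sum>a\<in>A. of_bool (u = a) * of_bool (v = a) * of_bool (w = a) :: real)
        = (\<Sum>a\<in>A. if a = u then of_bool (u = v \<and> u = w) else 0)"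
      by (intro sum.cong) auto
    then show ?thesis using fin(3) that by simp
  qed
  have pt: "of_bool (u \<noteq> v \<and> u \<noteq> w \<and> v \<noteq> w)
     = (1::real) - of_bool (u = v) - of_bool (u = w) - of_bool (v = w) + 2 * of_bool (u = v \<and> u = w)"
    for u v w :: nat by auto
  \<comment> \<open>The factors 1 give every sum the shape that \<open>sum_triple_product\<close>
    expects.\<close>
  have exp: "of_bool (col x \<noteq> col x' \<and> col x \<noteq> col y \<and> col x' \<noteq> col y)
     = 1 - (\<Sum>a\<in>A. e a x * e a x' * 1) - (\<Sum>a\<in>A. e a x * 1 * e a y) - (\<Sum>a\<in>A. 1 * e a x' * e a y)
       + 2 * (\<Sum>a\<in>A. e a x * e a x' * e a y)"
    if "x \<in> X" "x' \<in> X" "y \<in> Y" for x x' y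
    unfolding pt e_def mult_1_right mult_1 eq[OF col(1)[OF that(1)], of "col x'"]
      eq[OF col(1)[OF that(1)], of "col y"] eq[OF col(1)[OF that(2)], of "col y"]
      eq3[OF col(1)[OF that(1)], of "col x'" "col y"] by (rule refl)
  have "(\<Sum>x\<in>X. \<Sum>x'\<in>X. \<Sum>y\<in>Y. of_bool (col x \<noteq> col x' \<and> col x \<noteq> col y \<and> col x' \<noteq> col y))
     = (\<Sum>x\<in>X. \<Sum>x'\<in>X. \<Sum>y\<in>Y. 1 - (\<Sum>a\<in>A. e a x * e a x' * 1) - (\<Sum>a\<in>A. e a x * 1 * e a y)
         - (\<Sum>a\<in>A. 1 * e a x' * e a y) + 2 * (\<Sum>a\<in>A. e a x * e a x' * e a y))"
    by (intro sum.cong refl exp)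
  also have "\<dots> = card X * card X * card Y
       - (\<Sum>x\<in>X. \<Sum>x'\<in>X. \<Sum>y\<in>Y. \<Sum>a\<in>A. e a x * e a x' * 1)
       - (\<Sum>x\<in>X. \<Sum>x'\<in>X. \<Sum>y\<in>Y. \<Sum>a\<in>A. e a x * 1 * e a y)
       - (\<Sum>x\<in>X. \<Sum>x'\<in>X. \<Sum>y\<in>Y. \<Sum>a\<in>A. 1 * e a x' * e a y)
       + 2 * (\<Sum>x\<in>X. \<Sum>x'\<in>X. \<Sum>y\<in>Y. \<Sum>a\<in>A. e a x * e a x' * e a y)"
    by (simp only: sum.distrib sum_subtractf sum_distrib_left[symmetric]) simp
  also have "\<dots> = real (card X)^2 * card Y - card Y * (\<Sum>a\<in>A. k X a ^ 2)
      - 2 * card X * (\<Sum>a\<in>A. k X a * k Y a) + 2 * (\<Sum>a\<in>A. k X a ^ 2 * k Y a)"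
    unfolding sum_triple_product k[OF fin(1)] k[OF fin(2)]
    by (simp add: power2_eq_square sum_distrib_left sum_negf mult_ac)
  finally show ?thesis .
qed

text \<open>The left-hand side is the tangent at \<open>u\<close> of the right-hand side taken at \<open>s = f\<^sup>2\<close>.
  Below, \<open>f\<close> is the overall frequency of a symbol, \<open>s\<close> the second moment of its frequency in a random
  class, and \<open>u = 1 / b\<close>; summed over all symbols, the tangents depend only on \<open>\<Sum> f = 1\<close>.\<close>

lemma tangent_bound:
  fixes f s u :: real
  assumes f: "0 \<le> f" "f \<le> 1" and s: "f^2 \<le> s" "s \<le> f" and u: "0 \<le> u" "u \<le> 1/5"
  shows "6*u*(1-u)*f - 3*u^2 + 4*u^3 \<le> (1 - 2*f) * s + 2*f^2"
proof (cases "f \<le> 1/2")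
  case True
  \<comment> \<open>The bound grows with \<open>s\<close> here, so \<open>s = f^2\<close> is the
    worst case; the product is exactly the distance between curve and tangent.\<close>
  have "(f-u)^2 * (3 - 2*f - 4*u) \<ge> 0" using f u by (intro mult_nonneg_nonneg) auto
  moreover have "(1 - 2*f)*f^2 \<le> (1 - 2*f) * s" using True s by (intro mult_left_mono) auto
  ultimately show ?thesis by (simp add: algebra_simps power2_eq_square power3_eq_cube)
next
  case False
  \<comment> \<open>The coefficient of \<open>s\<close> is now negative, so the worst case is
    \<open>s = f\<close>.\<close>
  have "(2*f - 1) * s \<le> (2*f - 1)*f" using False s by (intro mult_left_mono) auto
  then have 1: "f \<le> (1 - 2*f) * s + 2*f^2" by (simp add: algebra_simps power2_eq_square)
  \<comment> \<open>The bound \<open>u \<le> 1/5\<close> matters here: at \<open>u = 1/4\<close> the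
    value of \<open>6*u*(1-u)\<close> would be 9/8.\<close>
  have "(1/5 - u)*(4/5 - u) \<ge> 0" using u by (intro mult_nonneg_nonneg) auto
  moreover have "(1/5 - u)*(4/5 - u) = 4/25 - u*(1-u)" by (simp add: field_simps)
  ultimately have "6*u*(1-u) \<le> 1" by simp
  then have "6*u*(1-u)*f \<le> f" using f by (metis mult_left_le_one_le mult_right_mono mult_1)
  moreover have "u^2 * (3 - 4*u) \<ge> 0" using u by (intro mult_nonneg_nonneg) auto
  ultimately show ?thesis using 1 by (simp add: algebra_simps power2_eq_square power3_eq_cube)
qed

lemma sum_card_constant_cover:
  assumes fin: "finite Z" "finite C" and sub: "S \<subseteq> C"
    and cover: "\<And>x. x \<in> C \<Longrightarrow> card {z \<in> Z. x \<in> D z} = V"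
  shows "(\<Sum>z\<in>Z. card {x \<in> S. x \<in> D z}) = V * card S"
proof -
  have finS: "finite S" using fin sub finite_subset by blast
  have "(\<Sum>z\<in>Z. card {x \<in> S. x \<in> D z}) = (\<Sum>x\<in>S. card {z \<in> Z. x \<in> D z})"
    using sum.swap_restrict[OF fin(1) finS, of "\<lambda>_ _. 1::nat" "\<lambda>z x. x \<in> D z"] by simp
  also have "\<dots> = V * card S" using cover sub by (simp add: subset_iff)
  finally show ?thesis .
qed

text \<open>Up to normalisation, a class is drawn with probability proportional to its size, then
  \<open>x\<close> and \<open>x'\<close> uniformly from it and \<open>y\<close> from
  \<open>C\<close>. The constant cover makes the mean frequency of symbol \<open>a\<close> in the
  class equal to \<open>f a\<close>, so the family enters only through the second moments
  \<open>s a\<close>.\<close>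

lemma rainbow_average_bound:
  fixes col :: "'a \<Rightarrow> nat" and D :: "'z \<Rightarrow> 'a set"
  assumes fin: "finite Z" "finite C" and C: "C \<noteq> {}"
    and sub: "\<And>z. z \<in> Z \<Longrightarrow> D z \<subseteq> C"
    and cover: "\<And>x. x \<in> C \<Longrightarrow> card {z \<in> Z. x \<in> D z} = V" and V: "V > 0"
    and col: "\<And>x. x \<in> C \<Longrightarrow> col x \<in> {1..b}" and b: "b \<ge> 5"
  shows "(\<Sum>z\<in>Z. (\<Sum>x\<in>D z. \<Sum>x'\<in>D z. \<Sum>y\<in>C.
       of_bool (col x \<noteq> col x' \<and> col x \<noteq> col y \<and> col x' \<noteq> col y)) / card (D z))
    \<le> (1 - 1 / b) * (1 - 2 / b) * V * real (card C)^2"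
proof -
  define A where "A = {1..b}"
  define k where "k = (\<lambda>S a. real (card {x \<in> S. col x = a}))"
  define M where "M = real (card C)"
  define W where "W = real V * M"
  define f where "f = (\<lambda>a. k C a / M)"
  define s where "s = (\<lambda>a. (\<Sum>z\<in>Z. k (D z) a ^ 2 / card (D z)) / W)"
  have M: "M > 0" using fin C by (simp add: M_def card_gt_0_iff)
  have W: "W > 0" using M V by (simp add: W_def)
  have finD: "finite (D z)" if "z \<in> Z" for z using sub[OF that] fin finite_subset by blast
  have kC: "k C a = M * f a" for a using M by (simp add: f_def)
  have sumD: "(\<Sum>z\<in>Z. real (card (D z))) = W"
  proof -
    have "D z = {x \<in> C. x \<in> D z}" if "z \<in> Z" for z using sub[OF that] by blast
    then have "(\<Sum>z\<in>Z. card (D z)) = (\<Sum>z\<in>Z. card {x \<in> C. x \<in> D z})"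
      by (intro sum.cong) auto
    also have "\<dots> = V * card C"
      using sum_card_constant_cover[OF fin order_refl cover] by blast
    finally show ?thesis by (simp add: W_def M_def flip: of_nat_sum)
  qed
  have sumk: "(\<Sum>z\<in>Z. k (D z) a) = W * f a" for a
  proof -
    have "{x \<in> D z. col x = a} = {x \<in> {x\<in>C. col x = a}. x \<in> D z}" if "z \<in> Z" for z
      using sub[OF that] by blast
    then have "(\<Sum>z\<in>Z. card {x \<in> D z. col x = a}) = (\<Sum>z\<in>Z. card {x \<in> {x\<in>C. col x = a}. x \<in> D z})"
      by (intro sum.cong) auto
    also have "\<dots> = V * card {x \<in> C. col x = a}"
      using sum_card_constant_cover[OF fin _ cover, of "{x \<in> C. col x = a}"] by blast
    finally have "(\<Sum>z\<in>Z. k (D z) a) = V * k C a" by (simp add: k_def flip: of_nat_sum)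
    then show ?thesis by (simp add: kC W_def)
  qed
  have k_le: "k (D z) a \<le> card (D z)" if "z \<in> Z" for z a
    unfolding k_def using finD[OF that] by (auto intro!: card_mono)
  have k0: "k S a \<ge> 0" for S a by (simp add: k_def)
  have sumf: "(\<Sum>a\<in>A. f a) = 1"
  proof -
    have "(\<Sum>a\<in>A. card {x \<in> C. col x = a}) = card C"
      using sum.group[of C A col "\<lambda>_. 1::nat"] image_subsetI[of C col A] col fin by (simp add: A_def)
    then have "(\<Sum>a\<in>A. k C a) = M" by (simp add: k_def M_def flip: of_nat_sum)
    then show ?thesis using M by (simp add: f_def flip: sum_divide_distrib)
  qed
  have f01: "0 \<le> f a" "f a \<le> 1" for a
  proof -
    have "k C a \<le> M" unfolding k_def M_def using fin by (auto intro!: card_mono)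
    then show "0 \<le> f a" "f a \<le> 1" using M k0[of C a] by (simp_all add: f_def)
  qed
  have s_le: "s a \<le> f a" for a
  proof -
    have "(\<Sum>z\<in>Z. k (D z) a ^ 2 / card (D z)) \<le> (\<Sum>z\<in>Z. k (D z) a)"
    proof (intro sum_mono)
      fix z assume "z \<in> Z"
      then have "k (D z) a * k (D z) a \<le> k (D z) a * card (D z)"
        using k_le k0 by (intro mult_left_mono) auto
      then show "k (D z) a ^ 2 / card (D z) \<le> k (D z) a"
        using k0[of "D z" a] by (cases "card (D z) = 0") (auto simp: power2_eq_square divide_le_eq)
    qed
    then show ?thesis using W by (simp add: s_def sumk divide_le_eq mult_ac)
  qed
  have s_ge: "f a ^ 2 \<le> s a" for a
  proof -
    \<comment> \<open>Cauchy-Schwarz in linearised form: the lower bound involves only the known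
      sums of \<open>k (D z) a\<close> and \<open>card (D z)\<close>.\<close>
    have "(\<Sum>z\<in>Z. 2 * f a * k (D z) a - f a ^ 2 * card (D z)) \<le> (\<Sum>z\<in>Z. k (D z) a ^ 2 / card (D z))"
    proof (intro sum_mono)
      fix z assume z: "z \<in> Z"
      show "2 * f a * k (D z) a - f a ^ 2 * card (D z) \<le> k (D z) a ^ 2 / card (D z)"
      proof (cases "card (D z) = 0")
        case True
        then show ?thesis using k_le[OF z, of a] k0[of "D z" a] by simp
      next
        case False
        have "(k (D z) a - f a * card (D z))^2 \<ge> 0" by simp
        then show ?thesis using False by (simp add: field_simps power2_eq_square)
      qed
    qed
    moreover have "(\<Sum>z\<in>Z. 2 * f a * k (D z) a - f a ^ 2 * card (D z)) = W * f a ^ 2"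
      by (simp add: sum_subtractf sum_distrib_left[symmetric] sumk sumD power2_eq_square)
    ultimately show ?thesis using W by (simp add: s_def le_divide_eq mult_ac)
  qed
  have per_class: "(\<Sum>x\<in>D z. \<Sum>x'\<in>D z. \<Sum>y\<in>C.
       of_bool (col x \<noteq> col x' \<and> col x \<noteq> col y \<and> col x' \<noteq> col y)) / card (D z)
     = M * card (D z) - (\<Sum>a\<in>A. M * (k (D z) a ^ 2 / card (D z)) + 2 * M * f a * k (D z) a
          - 2 * M * f a * (k (D z) a ^ 2 / card (D z)))" (is "?L / _ = ?R") if z: "z \<in> Z" for z
  proof (cases "card (D z) = 0")
    \<comment> \<open>An empty class contributes 0 to both sides, as division by 0 gives 0.\<close>
    case True
    then have "k (D z) a = 0" for a using k_le[OF z, of a] k0[of "D z" a] by simp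
    with True show ?thesis by simp
  next
    case False
    have "?L = real (card (D z))^2 * M - M * (\<Sum>a\<in>A. k (D z) a ^ 2)
      - 2 * card (D z) * (\<Sum>a\<in>A. k (D z) a * k C a) + 2 * (\<Sum>a\<in>A. k (D z) a ^ 2 * k C a)"
      unfolding M_def k_def
      by (rule rainbow_triple_sum) (use finD[OF z] fin sub[OF z] col in \<open>auto simp: A_def\<close>)
    also have "\<dots> = card (D z) * ?R"
      using False
      by (simp add: kC sum.distrib sum_subtractf sum_distrib_left sum_divide_distrib
            right_diff_distrib distrib_left power2_eq_square mult_ac)
    finally show ?thesis using False by simp
  qed
  have "(\<Sum>z\<in>Z. (\<Sum>x\<in>D z. \<Sum>x'\<in>D z. \<Sum>y\<in>C.
       of_bool (col x \<noteq> col x' \<and> col x \<noteq> col y \<and> col x' \<noteq> col y)) / card (D z))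
    = (\<Sum>z\<in>Z. M * card (D z)) - (\<Sum>z\<in>Z. \<Sum>a\<in>A. M * (k (D z) a ^ 2 / card (D z))
        + 2 * M * f a * k (D z) a - 2 * M * f a * (k (D z) a ^ 2 / card (D z)))"
    by (simp only: per_class sum_subtractf cong: sum.cong)
  also have "\<dots> = (\<Sum>z\<in>Z. M * card (D z)) - (\<Sum>a\<in>A. \<Sum>z\<in>Z. M * (k (D z) a ^ 2 / card (D z))
        + 2 * M * f a * k (D z) a - 2 * M * f a * (k (D z) a ^ 2 / card (D z)))"
    by (subst sum.swap) simp
  also have "\<dots> = M * W - (\<Sum>a\<in>A. M * W * ((1 - 2 * f a) * s a + 2 * f a ^ 2))"
  proof -
    have "(\<Sum>z\<in>Z. k (D z) a ^ 2 / card (D z)) = W * s a" for a using W by (simp add: s_def)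
    then show ?thesis
      by (simp only: sum.distrib sum_subtractf sum_distrib_left[symmetric] sumk sumD)
         (simp add: algebra_simps power2_eq_square sum.distrib sum_subtractf sum_distrib_left)
  qed
  also have "\<dots> = M * W * (1 - (\<Sum>a\<in>A. (1 - 2 * f a) * s a + 2 * f a ^ 2))"
    by (simp add: sum_distrib_left[symmetric] right_diff_distrib)
  \<comment> \<open>With \<open>u = 1 / b\<close> and frequencies summing to 1, the \<open>b\<close>
    tangents add up to \<open>3*u - 2*u^2\<close>, and \<open>1 - 3*u + 2*u^2\<close> is the claimed
    product.\<close>
  also have "\<dots> \<le> M * W * (1 - (\<Sum>a\<in>A. 6*(1/b)*(1-1/b)*f a - 3*(1/b)^2 + 4*(1/b)^3))"
    using M W b f01 s_ge s_le
    by (intro mult_left_mono diff_left_mono sum_mono tangent_bound) (auto simp: divide_le_eq)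
  also have "(\<Sum>a\<in>A. 6*(1/b)*(1-1/b)*f a - 3*(1/b)^2 + 4*(1/b)^3)
      = 6*(1/b)*(1-1/b) - b * (3*(1/b)^2) + b * (4*(1/b)^3)"
    by (simp only: sum.distrib sum_subtractf sum_distrib_left[symmetric] sumf) (simp add: A_def)
  also have "1 - \<dots> = (1 - 1 / b) * (1 - 2 / b)"
    using b by (simp add: field_simps power2_eq_square power3_eq_cube)
  finally show ?thesis by (simp add: W_def M_def power2_eq_square mult_ac)
qed

section \<open>Classes of codewords near prescribed block centres\<close>

text \<open>The size is independent of \<open>v\<close>. Taking \<open>v\<close> to be a block of a
  codeword and \<open>w\<close> its possible centres, every codeword is covered equally
  often.\<close>

lemma card_hamming_ball_one:
  assumes fin: "finite I" and v: "v \<in> PiE I (\<lambda>_. {1..b})"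
  shows "card {w \<in> PiE I (\<lambda>_. {1..b}). card {t \<in> I. w t \<noteq> v t} \<le> 1} = 1 + card I * (b - 1)"
proof -
  define P where "P = (SIGMA t:I. {1..b} - {v t})"
  define g where "g = (\<lambda>(t, s). v(t := s))"
  have "{w \<in> PiE I (\<lambda>_. {1..b}). card {t \<in> I. w t \<noteq> v t} \<le> 1} = insert v (g ` P)" (is "?B = _")
  proof (intro equalityI subsetI)
    fix w assume w: "w \<in> ?B"
    show "w \<in> insert v (g ` P)"
    proof (cases "w = v")
      case False
      then obtain t where t: "t \<in> I" "w t \<noteq> v t"
        using w v by (metis (no_types, lifting) PiE_ext mem_Collect_eq)
      have eq: "w r = v r" if "r \<noteq> t" for r
      proof (cases "r \<in> I")
        case True
        have "finite {r \<in> I. w r \<noteq> v r}" using fin by simp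
        then show ?thesis
          using w t that True by (auto simp: card_le_Suc0_iff_eq)
      next
        case False
        then show ?thesis using w v by (auto simp: PiE_arb[of w] PiE_arb[of v])
      qed
      have "w = v(t := w t)"
        by (rule ext) (simp add: eq)
      moreover have "(t, w t) \<in> P" using w t by (auto simp: P_def PiE_iff)
      ultimately show ?thesis unfolding g_def by (metis (no_types, lifting) case_prod_conv image_eqI insertCI)
    qed auto
  next
    fix w assume "w \<in> insert v (g ` P)"
    then consider "w = v" | t s where "(t, s) \<in> P" "w = v(t := s)"
      unfolding g_def by auto
    then show "w \<in> ?B"
    proof cases
      case 2
      then have "{r \<in> I. w r \<noteq> v r} \<subseteq> {t}" by auto
      then have "card {r \<in> I. w r \<noteq> v r} \<le> 1" using card_mono[of "{t}"] by fastforce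
      moreover have "w \<in> PiE I (\<lambda>_. {1..b})" using 2 v by (auto simp: P_def PiE_iff extensional_def)
      ultimately show ?thesis by simp
    qed (use v in simp)
  qed
  moreover have "v \<notin> g ` P" by (auto simp: g_def P_def fun_eq_iff split: if_splits)
  moreover have "inj_on g P"
    by (auto simp: inj_on_def g_def P_def fun_eq_iff split: if_splits)
  moreover have "card P = card I * (b - 1)"
  proof -
    have "card ({1..b} - {v t}) = b - 1" if "t \<in> I" for t
      using v that by (subst card_Diff_subset) (auto simp: PiE_iff)
    then show ?thesis unfolding P_def using fin by (simp add: card_SigmaI)
  qed
  moreover have "finite P" unfolding P_def using fin by auto
  ultimately show ?thesis by (simp add: card_image)
qed

text \<open>Hansel's inequality is summed over ordered pairs of distinct members of each class.
  Inside the blocks a pair differs at most twice per block; elsewhere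
  \<open>rainbow_average_bound\<close> applies coordinate by coordinate. There are
  \<open>b ^ (T * q)\<close> classes, and each codeword lies in \<open>V\<close> of them.\<close>

lemma hash_code_inequality:
  fixes b n q T :: nat
  assumes code: "is_hash_code b 4 n C" and b: "b \<ge> 5" and M3: "card C \<ge> 3" and qT: "q * T \<le> n"
  defines "M \<equiv> real (card C)" and "V \<equiv> (1 + T * (b - 1)) ^ q"
  shows "(V * M - real b ^ (T * q)) * ((M - 2) * ln (M - 2))
    \<le> ln (real b - 2) * (V * M^2 * (2 * q + (1 - 1 / b) * (1 - 2 / b) * (real n - q * T)))"
proof -
  define Z where "Z = PiE {0..<q} (\<lambda>_. PiE {0..<T} (\<lambda>_. {1..b}))"
  define near where "near = (\<lambda>(z :: nat \<Rightarrow> nat) j x. card {t \<in> {0..<T}. z t \<noteq> x (j * T + t)} \<le> 1)"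
  define D where "D = (\<lambda>z. {x \<in> C. \<forall>j \<in> {0..<q}. near (z j) j x})"
  define \<kappa> where "\<kappa> = (1 - 1 / real b) * (1 - 2 / real b)"
  define \<rho> where "\<rho> = (\<lambda>x x' y. real (card (rainbow {0..<n} x x' y)))"
  define \<beta> where "\<beta> = (\<lambda>(i::nat) x x' y. of_bool (x i \<noteq> x' i \<and> x i \<noteq> y i \<and> x' i \<noteq> (y i :: nat)) :: real)"
  have finC: "finite C" using code by (rule hash_code_finite)
  have finZ: "finite Z" unfolding Z_def by (intro finite_PiE) auto
  have cardZ: "real (card Z) = real b ^ (T * q)"
    unfolding Z_def by (simp add: card_PiE power_mult)
  have DC: "D z \<subseteq> C" for z by (auto simp: D_def)
  have finD: "finite (D z)" for z using DC finC finite_subset by blast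
  have cover: "card {z \<in> Z. x \<in> D z} = V" if x: "x \<in> C" for x
  proof -
    \<comment> \<open>The conditions on different blocks are independent, so the centres admitting
      \<open>x\<close> form a product of Hamming balls.\<close>
    have "{z \<in> Z. x \<in> D z} = PiE {0..<q} (\<lambda>j. {w \<in> PiE {0..<T} (\<lambda>_. {1..b}). near w j x})"
      using x unfolding Z_def D_def set_eq_iff mem_Collect_eq PiE_iff by blast
    also have "card \<dots> = (\<Prod>j\<in>{0..<q}. 1 + T * (b - 1))"
    proof (subst card_PiE, simp, intro prod.cong refl)
      fix j assume j: "j \<in> {0..<q}"
      define v where "v = (\<lambda>t\<in>{0..<T}. x (j * T + t))"
      have "j * T + t < n" if "t < T" for t
      proof -
        have "j * T + t < Suc j * T" using that by simp
        also have "\<dots> \<le> q * T" using j by (intro mult_right_mono) auto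
        finally show ?thesis using qT by simp
      qed
      then have "v \<in> PiE {0..<T} (\<lambda>_. {1..b})"
        using hash_code_symbol[OF code x] by (auto simp: v_def)
      moreover have "{t \<in> {0..<T}. w t \<noteq> x (j * T + t)} = {t \<in> {0..<T}. w t \<noteq> v t}" for w
        by (auto simp: v_def)
      ultimately show "card {w \<in> PiE {0..<T} (\<lambda>_. {1..b}). near w j x} = 1 + T * (b - 1)"
        using card_hamming_ball_one[of "{0..<T}" v b] by (simp add: near_def)
    qed
    also have "\<dots> = V" by (simp add: V_def)
    finally show ?thesis .
  qed
  have V: "V > 0" by (simp add: V_def)
  have M: "M \<ge> 3" using M3 by (simp add: M_def)
  have C: "C \<noteq> {}" using M3 by auto
  have sumD: "(\<Sum>z\<in>Z. real (card (D z))) = V * M"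
  proof -
    have "(\<Sum>z\<in>Z. card {x \<in> C. x \<in> D z}) = V * card C"
      using sum_card_constant_cover[OF finZ finC order_refl cover] by blast
    moreover have "{x \<in> C. x \<in> D z} = D z" for z using DC[of z] by blast
    ultimately show ?thesis by (simp add: M_def flip: of_nat_sum)
  qed
  \<comment> \<open>Where \<open>x\<close> and \<open>x'\<close> differ, at least one of them
    deviates from the centre, and each does so at most once per block.\<close>
  have prefix: "card (rainbow {0..<q * T} x x' y) \<le> 2 * q" if "x \<in> D z" "x' \<in> D z" for x x' y z
  proof -
    define E where "E = (\<lambda>x j. {t \<in> {0..<T}. z j t \<noteq> x (j * T + t)})"
    have "rainbow {0..<q * T} x x' y \<subseteq> (\<Union>j\<in>{0..<q}. (\<lambda>t. j * T + t) ` (E x j \<union> E x' j))"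
    proof
      fix i assume "i \<in> rainbow {0..<q * T} x x' y"
      then have i: "i < q * T" "x i \<noteq> x' i" by (auto simp: rainbow_def)
      then have "T > 0" by (cases T) auto
      then have "i div T < q" "i mod T < T" "i = i div T * T + i mod T"
        using i(1) by (auto simp: less_mult_imp_div_less)
      moreover from this(3) i(2) have "z (i div T) (i mod T) \<noteq> x (i div T * T + i mod T)
          \<or> z (i div T) (i mod T) \<noteq> x' (i div T * T + i mod T)" by metis
      ultimately show "i \<in> (\<Union>j\<in>{0..<q}. (\<lambda>t. j * T + t) ` (E x j \<union> E x' j))"
        by (intro UN_I[of "i div T"] image_eqI[of _ _ "i mod T"]) (auto simp: E_def)
    qed
    then have "card (rainbow {0..<q * T} x x' y)
        \<le> card (\<Union>j\<in>{0..<q}. (\<lambda>t. j * T + t) ` (E x j \<union> E x' j))"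
      by (intro card_mono) (auto simp: E_def)
    also have "\<dots> \<le> (\<Sum>j\<in>{0..<q}. card ((\<lambda>t. j * T + t) ` (E x j \<union> E x' j)))"
      by (intro card_UN_le) simp
    also have "\<dots> \<le> (\<Sum>j\<in>{0..<q}. 2)"
    proof (intro sum_mono)
      fix j assume j: "j \<in> {0..<q}"
      have "card ((\<lambda>t. j * T + t) ` (E x j \<union> E x' j)) \<le> card (E x j \<union> E x' j)"
        by (intro card_image_le) (auto simp: E_def)
      also have "\<dots> \<le> card (E x j) + card (E x' j)" by (rule card_Un_le)
      also have "\<dots> \<le> 1 + 1"
        using that j unfolding D_def near_def E_def by (intro add_mono) auto
      finally show "card ((\<lambda>t. j * T + t) ` (E x j \<union> E x' j)) \<le> 2" by simp
    qed
    finally show ?thesis by simp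
  qed
  have rho: "\<rho> x x' y \<le> 2 * q + (\<Sum>i\<in>{q*T..<n}. \<beta> i x x' y)" if "x \<in> D z" "x' \<in> D z" for x x' y z
  proof -
    have "rainbow {0..<n} x x' y = rainbow {0..<q*T} x x' y \<union> rainbow {q*T..<n} x x' y"
      using qT by (auto simp: rainbow_def)
    then have "card (rainbow {0..<n} x x' y) \<le> 2 * q + card (rainbow {q*T..<n} x x' y)"
      using prefix[OF that, of y] card_Un_le[of "rainbow {0..<q*T} x x' y" "rainbow {q*T..<n} x x' y"] by simp
    moreover have "(\<Sum>i\<in>{q*T..<n}. \<beta> i x x' y) = card (rainbow {q*T..<n} x x' y)"
      by (simp add: \<beta>_def rainbow_def of_bool_def sum.If_cases Int_def)
    ultimately show ?thesis unfolding \<rho>_def by linarith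
  qed
  define \<Lambda> where "\<Lambda> = (M - 2) * ln (M - 2)"
  have \<Lambda>: "\<Lambda> \<ge> 0" using M by (simp add: \<Lambda>_def)
  have lnb: "ln (real b - 2) \<ge> 0" using b by simp
  have hansel: "\<Lambda> \<le> ln (real b - 2) * (\<Sum>y\<in>C. \<rho> x x' y)" if "x \<in> C" "x' \<in> C" "x \<noteq> x'" for x x'
    unfolding \<Lambda>_def M_def \<rho>_def using hash_code_hansel[OF code that] b by simp
  \<comment> \<open>A class with \<open>m > 0\<close> members has \<open>m * (m - 1)\<close> ordered
    pairs, which the weight \<open>1 / m\<close> turns into \<open>m - 1\<close>. An empty class
    contributes \<open>-\<Lambda>\<close>, which is at most 0.\<close>
  have "(V * M - real b ^ (T * q)) * \<Lambda> = (\<Sum>z\<in>Z. (real (card (D z)) - 1) * \<Lambda>)"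
    by (simp add: sum_distrib_right[symmetric] sum_subtractf sumD cardZ)
  also have "\<dots> \<le> (\<Sum>z\<in>Z. ln (real b - 2) * ((\<Sum>x\<in>D z. \<Sum>x'\<in>D z. \<Sum>y\<in>C. \<rho> x x' y) / card (D z)))"
  proof (intro sum_mono)
    fix z assume "z \<in> Z"
    show "(real (card (D z)) - 1) * \<Lambda>
        \<le> ln (real b - 2) * ((\<Sum>x\<in>D z. \<Sum>x'\<in>D z. \<Sum>y\<in>C. \<rho> x x' y) / card (D z))"
    proof (cases "card (D z) = 0")
      case False
      have "real (card (D z)) * ((real (card (D z)) - 1) * \<Lambda>) = (\<Sum>x\<in>D z. \<Sum>x'\<in>D z - {x}. \<Lambda>)"
      proof -
        have "real (card (D z - {x})) = real (card (D z)) - 1" if "x \<in> D z" for x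
          using card_Suc_Diff1[OF finD that] by linarith
        then show ?thesis by (simp cong: sum.cong)
      qed
      also have "\<dots> \<le> (\<Sum>x\<in>D z. \<Sum>x'\<in>D z. ln (real b - 2) * (\<Sum>y\<in>C. \<rho> x x' y))"
      proof (intro sum_mono)
        fix x assume x: "x \<in> D z"
        have "(\<Sum>x'\<in>D z - {x}. \<Lambda>) \<le> (\<Sum>x'\<in>D z - {x}. ln (real b - 2) * (\<Sum>y\<in>C. \<rho> x x' y))"
          using x DC[of z] by (intro sum_mono hansel) auto
        \<comment> \<open>The diagonal \<open>x' = x\<close> is added because the averaged bound
          draws both members independently.\<close>
        also have "\<dots> \<le> (\<Sum>x'\<in>D z. ln (real b - 2) * (\<Sum>y\<in>C. \<rho> x x' y))"
          using finD lnb by (intro sum_mono2 mult_nonneg_nonneg sum_nonneg) (auto simp: \<rho>_def)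
        finally show "(\<Sum>x'\<in>D z - {x}. \<Lambda>) \<le> (\<Sum>x'\<in>D z. ln (real b - 2) * (\<Sum>y\<in>C. \<rho> x x' y))" .
      qed
      also have "\<dots> = ln (real b - 2) * (\<Sum>x\<in>D z. \<Sum>x'\<in>D z. \<Sum>y\<in>C. \<rho> x x' y)"
        by (simp only: sum_distrib_left)
      finally show ?thesis using False by (simp add: le_divide_eq mult_ac)
    qed (use \<Lambda> in simp)
  qed
  also have "\<dots> = ln (real b - 2) * (\<Sum>z\<in>Z. (\<Sum>x\<in>D z. \<Sum>x'\<in>D z. \<Sum>y\<in>C. \<rho> x x' y) / card (D z))"
    by (simp only: sum_distrib_left)
  also have "\<dots> \<le> ln (real b - 2) * (V * M^2 * (2 * q + \<kappa> * (real n - q * T)))"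
  proof (intro mult_left_mono lnb)
    have "(\<Sum>z\<in>Z. (\<Sum>x\<in>D z. \<Sum>x'\<in>D z. \<Sum>y\<in>C. \<rho> x x' y) / card (D z))
       \<le> (\<Sum>z\<in>Z. (\<Sum>x\<in>D z. \<Sum>x'\<in>D z. \<Sum>y\<in>C. 2 * q + (\<Sum>i\<in>{q*T..<n}. \<beta> i x x' y)) / card (D z))"
      by (intro sum_mono divide_right_mono rho) auto
    also have "\<dots> = (\<Sum>z\<in>Z. 2 * q * M * card (D z)
         + (\<Sum>i\<in>{q*T..<n}. (\<Sum>x\<in>D z. \<Sum>x'\<in>D z. \<Sum>y\<in>C. \<beta> i x x' y) / card (D z)))"
    proof (intro sum.cong refl)
      fix z assume "z \<in> Z"
      have "(\<Sum>x\<in>D z. \<Sum>x'\<in>D z. \<Sum>y\<in>C. 2 * q + (\<Sum>i\<in>{q*T..<n}. \<beta> i x x' y))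
        = card (D z) * (card (D z) * (M * (2 * q)))
          + (\<Sum>x\<in>D z. \<Sum>x'\<in>D z. \<Sum>y\<in>C. \<Sum>i\<in>{q*T..<n}. \<beta> i x x' y)"
        by (simp add: sum.distrib M_def)
      also have "(\<Sum>x\<in>D z. \<Sum>x'\<in>D z. \<Sum>y\<in>C. \<Sum>i\<in>{q*T..<n}. \<beta> i x x' y)
        = (\<Sum>i\<in>{q*T..<n}. \<Sum>x\<in>D z. \<Sum>x'\<in>D z. \<Sum>y\<in>C. \<beta> i x x' y)"
        by (simp only: sum.swap[of _ _ "{q*T..<n}"])
      finally show "(\<Sum>x\<in>D z. \<Sum>x'\<in>D z. \<Sum>y\<in>C. 2 * q + (\<Sum>i\<in>{q*T..<n}. \<beta> i x x' y)) / card (D z)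
        = 2 * q * M * card (D z)
         + (\<Sum>i\<in>{q*T..<n}. (\<Sum>x\<in>D z. \<Sum>x'\<in>D z. \<Sum>y\<in>C. \<beta> i x x' y) / card (D z))"
        by (cases "card (D z) = 0") (auto simp: add_divide_distrib sum_divide_distrib mult_ac)
    qed
    also have "\<dots> = 2 * q * M * (V * M)
         + (\<Sum>i\<in>{q*T..<n}. \<Sum>z\<in>Z. (\<Sum>x\<in>D z. \<Sum>x'\<in>D z. \<Sum>y\<in>C. \<beta> i x x' y) / card (D z))"
      by (simp only: sum.distrib sum_distrib_left[symmetric] sumD sum.swap[of _ "{q*T..<n}"])
    also have "\<dots> \<le> 2 * q * M * (V * M) + (\<Sum>i\<in>{q*T..<n}. \<kappa> * V * M^2)"
    proof (intro add_left_mono sum_mono)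
      fix i assume "i \<in> {q*T..<n}"
      then have "x i \<in> {1..b}" if "x \<in> C" for x using hash_code_symbol[OF code that] by simp
      then show "(\<Sum>z\<in>Z. (\<Sum>x\<in>D z. \<Sum>x'\<in>D z. \<Sum>y\<in>C. \<beta> i x x' y) / card (D z)) \<le> \<kappa> * V * M^2"
        unfolding \<beta>_def \<kappa>_def M_def
        by (intro rainbow_average_bound[OF finZ finC C DC cover V _ b])
    qed
    also have "\<dots> = V * M^2 * (2 * q + \<kappa> * (real n - q * T))"
      using qT by (simp add: of_nat_diff algebra_simps power2_eq_square)
    finally show "(\<Sum>z\<in>Z. (\<Sum>x\<in>D z. \<Sum>x'\<in>D z. \<Sum>y\<in>C. \<rho> x x' y) / card (D z))
      \<le> V * M^2 * (2 * q + \<kappa> * (real n - q * T))" .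
  qed
  finally show ?thesis by (simp only: \<Lambda>_def \<kappa>_def)
qed

text \<open>For \<open>T = b ^ 5\<close> a Hamming ball has at least \<open>b ^ 5\<close> elements,
  so the number of classes is at most a fraction \<open>\<theta>\<close> of their total size
  \<open>V * M\<close>. The rest is division by \<open>V * M^2\<close>.\<close>

lemma hash_code_inequality_normalized:
  fixes b n q :: nat and \<theta> :: real
  assumes code: "is_hash_code b 4 n C" and b: "b \<ge> 5" and M3: "card C \<ge> 3" and qT: "q * b ^ 5 \<le> n"
    and \<theta>: "real b ^ ((b ^ 5 - 5) * q) \<le> \<theta> * card C"
  shows "(1 - \<theta>) * (1 - 2 / card C) * ln (real (card C) - 2)
    \<le> ln (real b - 2) * (2 * q + (1 - 1 / b) * (1 - 2 / b) * (real n - q * real b ^ 5))"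
proof -
  define T where "T = b ^ 5"
  define M where "M = real (card C)"
  define V where "V = real ((1 + T * (b - 1)) ^ q)"
  define X where "X = 2 * q + (1 - 1 / b) * (1 - 2 / b) * (real n - q * real b ^ 5)"
  have M: "M \<ge> 3" using M3 by (simp add: M_def)
  have T5: "T \<ge> 5"
    using b power_increasing[of 1 5 b] by (simp add: T_def)
  have "T * 1 \<le> T * (b - 1)" using b by (intro mult_left_mono) auto
  then have "b ^ 5 \<le> 1 + T * (b - 1)" unfolding T_def by linarith
  then have "(b ^ 5) ^ q \<le> (1 + T * (b - 1)) ^ q" by (intro power_mono) auto
  then have V: "real b ^ (5 * q) \<le> V"
    unfolding V_def power_mult by (metis of_nat_le_iff of_nat_power)
  have V0: "V > 0" by (simp add: V_def add_pos_nonneg)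
  have "real b ^ (T * q) = real b ^ ((T - 5) * q) * real b ^ (5 * q)"
    using T5 by (simp add: diff_mult_distrib mult_le_mono flip: power_add)
  also have "\<dots> \<le> (\<theta> * M) * V"
    using V \<theta> by (intro mult_mono) (auto simp: T_def M_def intro: order_trans[rotated])
  finally have *: "(1 - \<theta>) * (V * M) \<le> V * M - real b ^ (T * q)" by (simp add: algebra_simps)
  have "(1 - \<theta>) * (V * M) * ((M - 2) * ln (M - 2)) \<le> (V * M - real b ^ (T * q)) * ((M - 2) * ln (M - 2))"
    using * M by (intro mult_right_mono) auto
  also have "\<dots> \<le> ln (real b - 2) * (V * M^2 * X)"
    using hash_code_inequality[OF code b M3, of q T] qT unfolding V_def M_def X_def T_def by simp
  also have "(1 - \<theta>) * (V * M) * ((M - 2) * ln (M - 2)) = (V * M^2) * ((1 - \<theta>) * (1 - 2 / M) * ln (M - 2))"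
    using M by (simp add: field_simps power2_eq_square)
  finally have "(V * M^2) * ((1 - \<theta>) * (1 - 2 / M) * ln (M - 2)) \<le> (V * M^2) * (ln (real b - 2) * X)"
    by (simp only: mult.left_commute)
  then show ?thesis
    using V0 M unfolding M_def X_def by (subst (asm) mult_le_cancel_left_pos) auto
qed

section \<open>Asymptotic choice of the number of blocks\<close>

text \<open>After division by \<open>n\<close> the two sides tend to \<open>l * k\<close> and
  \<open>r\<close>. The constants \<open>c\<close> and \<open>d\<close> leave room for bounded
  losses.\<close>

lemma exponent_gap_eventually_positive:
  fixes \<eta> r l k c d :: real
  assumes "\<eta> > 0" "r > 0" "r > l * k"
  shows "eventually (\<lambda>n::nat. l * (k * n + d)
     < (1 - exp (- \<eta> * n)) * (1 - 2 * exp (- r * n)) * (r * n - c)) at_top"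
proof -
  have "((\<lambda>n::nat. (1 - exp (- \<eta> * n)) * (1 - 2 * exp (- r * n)) * (r - c / n)) \<longlongrightarrow> r) at_top"
    using assms by real_asymp
  moreover have "((\<lambda>n::nat. l * (k + d / n)) \<longlongrightarrow> l * k) at_top"
    by real_asymp
  ultimately have "((\<lambda>n::nat. (1 - exp (- \<eta> * n)) * (1 - 2 * exp (- r * n)) * (r - c / n)
      - l * (k + d / n)) \<longlongrightarrow> r - l * k) at_top"
    by (rule tendsto_diff)
  from order_tendstoD(1)[OF this, of 0]
  have "eventually (\<lambda>n::nat. (1 - exp (- \<eta> * n)) * (1 - 2 * exp (- r * n)) * (r - c / n)
      - l * (k + d / n) > 0) at_top"
    using assms(3) by simp
  then show ?thesis using eventually_gt_at_top[of 0]
  proof eventually_elim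
    case (elim n)
    define P where "P = (1 - exp (- \<eta> * n)) * (1 - 2 * exp (- r * n))"
    have "n * (l * (k + d / n)) < n * (P * (r - c / n))"
      using elim by (intro mult_strict_left_mono) (auto simp: P_def)
    moreover have "n * (r - c / n) = r * n - c" "n * (k + d / n) = k * n + d"
      using elim by (auto simp: field_simps)
    ultimately show ?case
      by (simp only: P_def mult.left_commute[of "real n"])
  qed
qed

text \<open>Plain prefixes lead to the fixed point
  \<open>\<rho> = l * \<kappa> * (1 - \<rho> / L)\<close>. Blocks replace \<open>\<kappa>\<close> in
  the subtracted term by a larger \<open>\<mu>\<close>, which leaves room for a gap
  \<open>\<eta>\<close> independent of \<open>n\<close>.\<close>

lemma hash_code_rate_strict_bound:
  fixes b :: nat and \<rho> :: real
  assumes b: "b \<ge> 5"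
    and \<rho>: "\<rho> = inverse (1 / ln b + 1 / ((1 - 1 / b) * (1 - 2 / b) * ln (real b - 2)))"
  obtains \<eta> where "0 < \<eta>" "\<eta> < \<rho>"
    and "eventually (\<lambda>n. \<forall>C. is_hash_code b 4 n C \<longrightarrow> real (card C) \<le> exp ((\<rho> - \<eta>) * n)) at_top"
proof -
  define T where "T = real b ^ 5"
  define L where "L = ln (real b)"
  define l where "l = ln (real b - 2)"
  define \<kappa> where "\<kappa> = (1 - 1 / real b) * (1 - 2 / real b)"
  \<comment> \<open>A block lowers the rainbow bound by \<open>\<kappa> * T - 2\<close> and costs a
    factor \<open>b ^ (T - 5)\<close> in class size. So \<open>\<mu>\<close> is the saving per
    factor \<open>b\<close>, against \<open>\<kappa>\<close> for a plain prefix.\<close>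
  define \<mu> where "\<mu> = (\<kappa> * T - 2) / (T - 5)"
  have T: "T \<ge> 10"
  proof -
    have "(5::real) ^ 5 \<le> real b ^ 5" using b by (intro power_mono) auto
    then show ?thesis by (simp add: T_def)
  qed
  have L: "L > 0" and l: "l > 0" and lL: "l \<le> L" using b by (auto simp: L_def l_def)
  have \<kappa>1: "\<kappa> \<le> 1"
    unfolding \<kappa>_def using b by (intro mult_le_one) (auto simp: divide_le_eq)
  have "(4/5) * (3/5) \<le> \<kappa>"
    unfolding \<kappa>_def using b by (intro mult_mono) (auto simp: field_simps)
  then have \<kappa>: "5 * \<kappa> > 2" by simp
  have \<mu>T: "\<mu> * (T - 5) = \<kappa> * T - 2" using T by (simp add: \<mu>_def)
  have "\<kappa> * (T - 5) < \<mu> * (T - 5)" unfolding \<mu>T using \<kappa> by (simp add: algebra_simps)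
  then have \<mu>: "\<mu> > \<kappa>" using T by simp
  have \<rho>': "\<rho> = inverse (1 / L + 1 / (\<kappa> * l))"
    using \<rho> by (simp add: \<kappa>_def L_def l_def)
  have \<rho>0: "\<rho> > 0" using L l \<kappa> by (auto simp: \<rho>' intro!: add_pos_pos)
  have \<rho>_eq: "\<rho> = l * \<kappa> - l * \<kappa> * \<rho> / L"
  proof -
    have "1 / L + 1 / (\<kappa> * l) \<noteq> 0" using \<rho>0 unfolding \<rho>' by auto
    then have "\<kappa> * l * (\<rho> * (1 / L + 1 / (\<kappa> * l))) = \<kappa> * l" by (simp add: \<rho>')
    then show ?thesis using L l \<kappa> by (simp add: distrib_left mult_ac)
  qed
  \<comment> \<open>Combined with \<open>T \<le> 2 * (T - 5)\<close>, this makes the blocks fit into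
    \<open>n\<close> coordinates.\<close>
  have \<rho>L: "2 * \<rho> \<le> L"
  proof -
    have "\<kappa> * l \<le> 1 * L" using \<kappa>1 lL l by (intro mult_mono) auto
    then have "1 / L \<le> 1 / (\<kappa> * l)" using L l \<kappa> by (intro divide_left_mono) auto
    then have "\<rho> \<le> inverse (2 / L)" unfolding \<rho>' using L by (intro le_imp_inverse_le) auto
    then show ?thesis by simp
  qed
  \<comment> \<open>By \<open>\<rho>_eq\<close>, the inequality \<open>gap\<close> below amounts to
    \<open>\<eta> * w < \<delta>\<close>; the cap \<open>\<rho> / 4\<close> keeps
    \<open>\<rho> - 2 * \<eta>\<close> positive.\<close>
  define \<delta> where "\<delta> = l * (\<mu> - \<kappa>) * \<rho> / L"
  define w where "w = 1 + 2 * l * \<mu> / L"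
  define \<eta> where "\<eta> = min (\<rho> / 4) (\<delta> / (2 * w))"
  have \<delta>: "\<delta> > 0" using L l \<mu> \<rho>0 by (simp add: \<delta>_def)
  have w: "w > 0" using L l \<mu> \<kappa> by (simp add: w_def add_pos_pos)
  have \<eta>: "\<eta> > 0" "\<eta> \<le> \<rho> / 4" using \<delta> w \<rho>0 by (auto simp: \<eta>_def)
  have "\<eta> * w \<le> \<delta> / (2 * w) * w" using w by (intro mult_right_mono) (auto simp: \<eta>_def)
  also have "\<dots> < \<delta>" using w \<delta> by simp
  finally have "\<eta> * w < \<delta>" .
  then have gap: "\<rho> - \<eta> > l * (\<kappa> - \<mu> * (\<rho> - 2 * \<eta>) / L)"
    using \<rho>_eq by (simp add: \<delta>_def w_def algebra_simps diff_divide_distrib add_divide_distrib)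
  have "\<rho> - \<eta> > 0" using \<eta> \<rho>0 by simp
  have "eventually (\<lambda>n::nat. exp ((\<rho> - \<eta>) * n) \<ge> 3) at_top"
    using \<open>\<rho> - \<eta> > 0\<close> by real_asymp
  then have "eventually (\<lambda>n. \<forall>C. is_hash_code b 4 n C \<longrightarrow> real (card C) \<le> exp ((\<rho> - \<eta>) * n)) at_top"
    using exponent_gap_eventually_positive[OF \<eta>(1) \<open>\<rho> - \<eta> > 0\<close> gap, of "\<mu> * (T - 5)" "ln 3"]
  proof eventually_elim
    case (elim n)
    show ?case
    proof (intro allI impI leI notI)
      fix C assume code: "is_hash_code b 4 n C" and big: "exp ((\<rho> - \<eta>) * n) < real (card C)"
      define M where "M = real (card C)"
      \<comment> \<open>One \<open>\<eta>\<close> is the gap in the assumed size of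
        \<open>C\<close>; the other gives the exponentially small fraction
        \<open>\<theta> = exp (- \<eta> * n)\<close>.\<close>
      define y where "y = (\<rho> - 2 * \<eta>) * n / ((T - 5) * L)"
      define q where "q = nat \<lfloor>y\<rfloor>"
      define E where "E = exp (- (\<rho> - \<eta>) * n)"
      have M: "M \<ge> 3" using elim(1) big by (simp add: M_def)
      then have M3: "card C \<ge> 3" by (simp add: M_def)
      have "y \<ge> 0" using \<eta> \<rho>0 T L by (simp add: y_def)
      then have q: "q \<le> y" "y - 1 \<le> q" unfolding q_def by linarith+
      have yL: "(T - 5) * L * y = (\<rho> - 2 * \<eta>) * n" using T L by (simp add: y_def)
      have T5: "real (b ^ 5 - 5) = T - 5"
      proof -
        have "real (b ^ 5) \<ge> 5" using T by (simp add: T_def)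
        then have "b ^ 5 \<ge> 5" by linarith
        then show ?thesis by (simp add: of_nat_diff T_def)
      qed
      have "q * T \<le> y * T" using q T by (intro mult_right_mono) auto
      also have "\<dots> \<le> n"
      proof -
        have "(\<rho> - 2 * \<eta>) * T \<le> (L / 2) * (2 * (T - 5))"
          using \<rho>L \<eta> T \<rho>0 by (intro mult_mono) auto
        also have "\<dots> = (T - 5) * L" by simp
        finally have "((\<rho> - 2 * \<eta>) * T) * n \<le> ((T - 5) * L) * n"
          by (intro mult_right_mono) auto
        then show ?thesis using T L by (simp add: y_def divide_le_eq mult_ac)
      qed
      finally have "real (q * b ^ 5) \<le> real n" by (simp add: T_def)
      then have qT: "q * b ^ 5 \<le> n" by (simp only: of_nat_le_iff)
      have "real b ^ ((b ^ 5 - 5) * q) = exp (((T - 5) * q) * L)"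
      proof -
        have "real b ^ m = exp (real m * L)" for m
          using b by (simp add: L_def exp_of_nat_mult)
        then show ?thesis by (simp only: of_nat_mult T5)
      qed
      also have "\<dots> \<le> exp ((T - 5) * L * y)"
        using q T L by (simp add: mult_ac mult_left_mono)
      also have "\<dots> = exp (- \<eta> * n) * exp ((\<rho> - \<eta>) * n)"
        unfolding yL by (simp add: algebra_simps flip: exp_add)
      also have "\<dots> \<le> exp (- \<eta> * n) * card C" using big by (intro mult_left_mono) auto
      finally have main: "(1 - exp (- \<eta> * n)) * (1 - 2 / M) * ln (M - 2)
          \<le> l * (2 * q + \<kappa> * (real n - q * T))"
        using hash_code_inequality_normalized[OF code b M3 qT] by (simp add: M_def l_def \<kappa>_def T_def)
      have "2 * q + \<kappa> * (real n - q * T) = \<kappa> * n - \<mu> * (T - 5) * q"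
        unfolding \<mu>T by (simp add: algebra_simps)
      \<comment> \<open>Rounding \<open>y\<close> down to \<open>q\<close> loses at most the
        constant \<open>\<mu> * (T - 5)\<close>, before the factor \<open>l\<close>.\<close>
      also have "\<dots> \<le> \<kappa> * n - \<mu> * (T - 5) * (y - 1)"
        using q \<mu> \<kappa> T by (intro diff_left_mono mult_left_mono) auto
      also have "\<dots> = (\<kappa> - \<mu> * (\<rho> - 2 * \<eta>) / L) * n + \<mu> * (T - 5)"
        using T L by (simp add: y_def field_simps)
      finally have "l * (2 * q + \<kappa> * (real n - q * T))
          \<le> l * ((\<kappa> - \<mu> * (\<rho> - 2 * \<eta>) / L) * n + \<mu> * (T - 5))"
        using l by (intro mult_left_mono) auto
      also have "\<dots> < (1 - exp (- \<eta> * n)) * (1 - 2 * E) * ((\<rho> - \<eta>) * n - ln 3)"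
        using elim(2) unfolding E_def .
      also have "\<dots> \<le> (1 - exp (- \<eta> * n)) * (1 - 2 / M) * ln (M - 2)"
      proof (rule mult_mono[OF mult_left_mono])
        have E: "E = inverse (exp ((\<rho> - \<eta>) * n))" by (simp only: E_def exp_minus mult_minus_left)
        have "inverse M \<le> E" unfolding E M_def using big by (intro le_imp_inverse_le) auto
        then show "1 - 2 * E \<le> 1 - 2 / M" by (simp add: divide_inverse)
        have "(\<rho> - \<eta>) * n \<le> ln M" using big M by (simp add: M_def ln_ge_iff)
        then have "(\<rho> - \<eta>) * n - ln 3 \<le> ln (M / 3)" using M by (simp add: ln_div)
        \<comment> \<open>\<open>M \<ge> 3\<close> gives \<open>M / 3 \<le> M - 2\<close>.\<close>
        also have "\<dots> \<le> ln (M - 2)" using M by simp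
        finally show "(\<rho> - \<eta>) * n - ln 3 \<le> ln (M - 2)" .
        have "ln 3 \<le> ln (exp ((\<rho> - \<eta>) * n))" using elim(1) by (subst ln_le_cancel_iff) auto
        then show "0 \<le> (\<rho> - \<eta>) * n - ln 3" by simp
        show "0 \<le> (1 - exp (- \<eta> * n)) * (1 - 2 / M)" using M \<eta> by simp
        show "0 \<le> 1 - exp (- \<eta> * n)" using \<eta> by simp
      qed
      finally show False using main by simp
    qed
  qed
  moreover have "\<eta> < \<rho>" using \<open>\<rho> - \<eta> > 0\<close> by simp
  ultimately show ?thesis using \<eta>(1) that by blast
qed

section \<open>From code sizes to the rate\<close>

text \<open>\<open>Max\<close> is informative only on a finite nonempty set: there are finitely many
  sets of words, and for \<open>k > 0\<close> the empty code qualifies.\<close>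

lemma A_hash_attained:
  assumes "k > 0"
  obtains C where "is_hash_code b k n C" "card C = A_hash b k n"
proof -
  have "{C. is_hash_code b k n C} \<subseteq> Pow (words b n)" by (auto simp: is_hash_code_def)
  then have "finite {C. is_hash_code b k n C}" by (rule finite_subset) simp
  then have "finite {card C | C. is_hash_code b k n C}" by (rule finite_image_set)
  moreover have "is_hash_code b k n {}" using assms by (auto simp: is_hash_code_def)
  then have "{card C | C. is_hash_code b k n C} \<noteq> {}" by blast
  ultimately have "A_hash b k n \<in> {card C | C. is_hash_code b k n C}"
    unfolding A_hash_def by (intro Max_in)
  then show ?thesis using that by auto
qed

theorem mainTheorem16:
  fixes b :: nat
  assumes "b > 4"
  shows "R_hash b 4 < ereal (inverse (1 / log 2 (real b)
           + (real b)^2 / (((real b)^2 - 3 * real b + 2) * log 2 (real b - 2))))"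
proof -
  define \<kappa> where "\<kappa> = (1 - 1 / real b) * (1 - 2 / real b)"
  define \<rho> where "\<rho> = inverse (1 / ln b + 1 / (\<kappa> * ln (real b - 2)))"
  have b: "b \<ge> 5" using assms by simp
  obtain \<eta> where \<eta>: "0 < \<eta>" "\<eta> < \<rho>"
    and ev: "eventually (\<lambda>n. \<forall>C. is_hash_code b 4 n C \<longrightarrow> real (card C) \<le> exp ((\<rho> - \<eta>) * n)) at_top"
    using hash_code_rate_strict_bound[OF b] unfolding \<rho>_def \<kappa>_def by blast
  have "(real b)^2 - 3 * real b + 2 = \<kappa> * (real b)^2"
    using b by (simp add: \<kappa>_def field_simps power2_eq_square)
  then have "1 / log 2 (real b) + (real b)^2 / (((real b)^2 - 3 * real b + 2) * log 2 (real b - 2))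
      = ln 2 * (1 / ln b + 1 / (\<kappa> * ln (real b - 2)))"
    using b by (simp add: log_def distrib_left)
  then have bound: "inverse (1 / log 2 (real b)
           + (real b)^2 / (((real b)^2 - 3 * real b + 2) * log 2 (real b - 2))) = \<rho> / ln 2"
    by (simp add: \<rho>_def divide_inverse)
  \<comment> \<open>The gap \<open>\<eta>\<close> does not depend on \<open>n\<close>, so strictness
    survives the limsup.\<close>
  have "eventually (\<lambda>n. ereal (log 2 (real (A_hash b 4 n)) / real n) \<le> ereal ((\<rho> - \<eta>) / ln 2)) at_top"
    using ev eventually_gt_at_top[of 0]
  proof eventually_elim
    case (elim n)
    obtain C where "is_hash_code b 4 n C" "card C = A_hash b 4 n"
      by (rule A_hash_attained[of 4]) auto
    then have le: "real (A_hash b 4 n) \<le> exp ((\<rho> - \<eta>) * n)" using elim by metis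
    show ?case
    proof (cases "A_hash b 4 n = 0")
      case False
      then have "ln (real (A_hash b 4 n)) \<le> (\<rho> - \<eta>) * n"
        using le by (metis ln_exp ln_le_cancel_iff exp_gt_zero of_nat_0_less_iff gr0I)
      then have "ln (real (A_hash b 4 n)) / ln 2 \<le> (\<rho> - \<eta>) * n / ln 2"
        by (intro divide_right_mono) auto
      then show ?thesis using elim(2) by (simp add: log_def divide_le_eq)
    next
      \<comment> \<open>Here \<open>log 2 0\<close> is 0 by convention, and the bound is
        positive.\<close>
      case True
      then show ?thesis using \<eta> by (simp add: log_def)
    qed
  qed
  then have "R_hash b 4 \<le> ereal ((\<rho> - \<eta>) / ln 2)"
    unfolding R_hash_def by (rule Limsup_bounded)
  also have "\<dots> < ereal (\<rho> / ln 2)" using \<eta> by (simp add: divide_strict_right_mono)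
  finally show ?thesis unfolding bound .
qed

end
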